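(* Let $n\ge2$, let $R$ be a potential domain, and let $s$ be a non-zero $n$-dimensional sequence over $R$ indexed by $-\mathbb{N}^n$. Suppose that for all $i\in\{1,\dots,n\}$, $f_i\in\mathrm{Ann}(s)\cap R[X_i]$ with $\deg f_i\ge1$, and let $\Delta'_i=(\deg f_j-1)_{j\ne i}\in\mathbb{N}^{\{1,\dots,n\}\setminus\{i\}}$. Then for all $i\in\{1,\dots,n\}$, $$\mathrm{Ann}(s)\cap R[X_i]=\Big(\mathrm{lcm}\{\gamma(s^{(a')}) : -\Delta'_i\le a'\le\mathbf 0'\}\Big),$$ where the right-hand side is the ideal of $R[X_i]$ generated by the least common multiple, $a'$ ranges over $-\mathbb{N}^{\{1,\dots,n\}\setminus\{i\}}$, and $\mathbf 0'$ is the zero vector.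
   Context: A factorial domain (unique factorization domain) $R$ is called potential if for all $n\ge1$ the power series ring $R[[X_1^{-1},\dots,X_n^{-1}]]$ is factorial. $\mathbb{N}=\{0,1,2,\dots\}$; vectors are ordered componentwise; $X^a=X_1^{a_1}\cdots X_n^{a_n}$. An $n$-dimensional sequence is a function $s:-\mathbb{N}^n\to R$, $a\mapsto s_a$. $R[X_1,\dots,X_n]$ acts by right shifting: $(f\circ s)_b=\sum_af_as_{b-a}$ for $f=\sum_af_aX^a$, $b\le\mathbf 0$. $\mathrm{Ann}(s)=\{f\in R[X_1,\dots,X_n]:f\circ s=0\}$. Sections: for $i\in\{1,\dots,n\}$ and $a'\in-\mathbb{N}^{\{1,\dots,n\}\setminus\{i\}}$, $s^{(a')}$ is the 1-dimensional sequence $-\mathbb{N}\to R$ with $s^{(a')}_a=s_{(a,a')}$, where $(a,a')\in-\mathbb{N}^n$ has $i$-th component $a$ and remaining components $a'$. Its annihilator $\mathrm{Ann}(s^{(a')})$ is an ideal of $R[X_i]$. For a 1-dimensional sequence $t$ over a factorial domain with $\mathrm{Ann}(t)\ne(0)$, $\mathrm{Ann}(t)$ is generated by a primitive polynomial, unique up to a unit of $R$, denoted $\gamma(t)$ (for $t=0$ this is $1$). *)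

theory Defs
  imports
    "HOL-Algebra.Ring_Divisibility"
    "Berlekamp_Zassenhaus.Unique_Factorization_Poly"
    "HOL-Library.Poly_Mapping"
    "HOL-Library.FuncSet"
    "HOL-Analysis.Finite_Cartesian_Product"
begin

text \<open>
  The ring of formal power series over \<open>'a\<close> in the indeterminates number \<open>1, \<dots>, n\<close>. An exponent is a
  finitely supported function on \<open>nat\<close>, and a power series is a function from exponents to
  coefficients that vanishes at every exponent involving an index outside \<open>{1..n}\<close>. The pairs
  \<open>(a, b)\<close> with \<open>a + b = m\<close> are finite in number, so the Cauchy product is a genuine finite sum.
\<close>

definition power_series_ring :: "nat \<Rightarrow> ((nat \<Rightarrow>\<^sub>0 nat) \<Rightarrow> 'a::comm_ring_1) ring" where
  "power_series_ring n =
    \<lparr> carrier = {F. \<forall>m. F m \<noteq> 0 \<longrightarrow> Poly_Mapping.keys m \<subseteq> {1..n}},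
      mult = (\<lambda>F G m. \<Sum>(a, b) \<in> {(a, b). a + b = m}. F a * G b),
      one = (\<lambda>m. if m = 0 then 1 else 0),
      zero = (\<lambda>m. 0),
      add = (\<lambda>F G m. F m + G m) \<rparr>"

text \<open>That the coefficient ring itself is factorial is the type class \<^class>\<open>ufd\<close>.\<close>

definition potential :: "'a::ufd itself \<Rightarrow> bool" where
  "potential _ \<longleftrightarrow>
    (\<forall>n\<ge>1. factorial_domain (power_series_ring n :: ((nat \<Rightarrow>\<^sub>0 nat) \<Rightarrow> 'a) ring))"

text \<open>
  Polynomials in the indeterminates \<open>X\<^sub>i\<close> with \<open>i :: 'n\<close>; \<open>in_var i\<close> embeds univariate polynomials by
  substituting \<open>X\<^sub>i\<close>, so that its range is the subring \<open>R[X\<^sub>i]\<close>.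
\<close>

type_synonym ('a, 'n) mpoly = "('n \<Rightarrow>\<^sub>0 nat) \<Rightarrow>\<^sub>0 'a"

definition in_var :: "'n \<Rightarrow> 'a::comm_ring_1 poly \<Rightarrow> ('a, 'n) mpoly" where
  "in_var i p = (\<Sum>k\<le>degree p. Poly_Mapping.single (Poly_Mapping.single i k) (Polynomial.coeff p k))"

text \<open>
  With \<open>n = CARD('n)\<close>, a sequence indexed by the integer vectors \<open>\<le> 0\<close> is a function on all integer
  vectors whose values outside the index set are irrelevant: every notion below only uses
  arguments \<open>\<le> 0\<close>.
\<close>

definition shift :: "('a::comm_ring_1, 'n::finite) mpoly \<Rightarrow> (int ^ 'n \<Rightarrow> 'a) \<Rightarrow> int ^ 'n \<Rightarrow> 'a" where
  "shift f s b = (\<Sum>a\<in>Poly_Mapping.keys f. Poly_Mapping.lookup f a * s (b - (\<chi> j. int (Poly_Mapping.lookup a j))))"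

definition Ann :: "(int ^ 'n \<Rightarrow> 'a::comm_ring_1) \<Rightarrow> ('a, 'n::finite) mpoly set" where
  "Ann s = {f. \<forall>b\<le>0. shift f s b = 0}"

definition shift1 :: "'a::comm_ring_1 poly \<Rightarrow> (int \<Rightarrow> 'a) \<Rightarrow> int \<Rightarrow> 'a" where
  "shift1 f t b = (\<Sum>a\<le>degree f. Polynomial.coeff f a * t (b - int a))"

definition Ann1 :: "(int \<Rightarrow> 'a::comm_ring_1) \<Rightarrow> 'a poly set" where
  "Ann1 t = {f. \<forall>b\<le>0. shift1 f t b = 0}"

text \<open>The index \<open>(a, a')\<close> has \<open>i\<close>-th component \<open>a\<close>; the component \<open>a' i\<close> is ignored.\<close>

definition seq_section :: "(int ^ 'n \<Rightarrow> 'a) \<Rightarrow> 'n::finite \<Rightarrow> ('n \<Rightarrow> int) \<Rightarrow> int \<Rightarrow> 'a" where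
  "seq_section s i a' = (\<lambda>a. s (\<chi> j. if j = i then a else a' j))"

definition principal_ideal :: "'a::comm_ring_1 \<Rightarrow> 'a set" where
  "principal_ideal g = {h * g |h. True}"

text \<open>
  \<open>\<gamma>(t)\<close> and the least common multiple are only determined up to a unit; a representative is chosen.
\<close>

definition gamma :: "(int \<Rightarrow> 'a::ufd) \<Rightarrow> 'a poly" where
  "gamma t = (if \<forall>a\<le>0. t a = 0 then 1
              else (SOME g. primitive g \<and> Ann1 t = principal_ideal g))"

definition is_lcm :: "'a::comm_ring_1 set \<Rightarrow> 'a \<Rightarrow> bool" where
  "is_lcm A m \<longleftrightarrow> (\<forall>a\<in>A. a dvd m) \<and> (\<forall>c. (\<forall>a\<in>A. a dvd c) \<longrightarrow> m dvd c)"

definition some_lcm :: "'a::comm_ring_1 set \<Rightarrow> 'a" where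
  "some_lcm A = (SOME m. is_lcm A m)"

end

theory Submission
  imports Defs
begin

text \<open>
  A polynomial \<open>p\<close> in the single indeterminate \<open>X\<^sub>i\<close> shifts a sequence in direction \<open>i\<close> only, so it
  acts on each section in direction \<open>i\<close> separately: \<open>p\<close> annihilates \<open>s\<close> iff it annihilates every
  section \<open>s\<^bsup>(a')\<^esup>\<close> with \<open>a' \<le> 0\<close>. Two observations turn this into the claim.

  The sections in the box suffice (\<open>zero_on_box_imp_zero\<close>). Shifts in different directions
  commute, so \<open>u = p \<circ> s\<close> is again annihilated by every \<open>f\<^sub>j\<close>. For \<open>j \<noteq> i\<close>, the recurrence \<open>f\<^sub>j \<circ> u = 0\<close>
  expresses the leading coefficient of \<open>f\<^sub>j\<close> times a value of \<open>u\<close> through values of \<open>u\<close> closer to the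
  origin in direction \<open>j\<close>. As \<open>R\<close> is a domain, \<open>u\<close> vanishes everywhere once it vanishes at all
  indices \<open>b\<close> with \<open>-deg f\<^sub>j < b\<^sub>j\<close> for \<open>j \<noteq> i\<close>, and the latter says that \<open>p\<close> annihilates the
  sections in the box.

  The ideals in question are principal (\<open>saturated_ideal_principal\<close>). An ideal \<open>I\<close> of \<open>R[X]\<close> that
  contains \<open>f\<close> as soon as it contains \<open>c f\<close> for some constant \<open>c \<noteq> 0\<close> is the contraction of an ideal
  over the field of fractions. An element of least degree generates \<open>I\<close> up to constants, and if
  it is primitive then it generates \<open>I\<close> itself by Gauss's lemma. Annihilators of one-dimensional
  sequences over a domain have this property, and it passes to intersections. So the
  annihilator of each section is generated by its \<open>\<gamma>\<close>, and the intersection over the box has a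
  generator, which is then a least common multiple of these \<open>\<gamma>\<close>.
\<close>

section \<open>Ideals saturated with respect to constants\<close>

lemma mem_principal_ideal_iff: "f \<in> principal_ideal g \<longleftrightarrow> g dvd f"
  by (auto simp: principal_ideal_def dvd_def mult.commute)

lemma exists_primitive_part:
  fixes f :: "'a::ufd poly"
  assumes "f \<noteq> 0"
  shows "\<exists>c g. c \<noteq> 0 \<and> primitive g \<and> f = Polynomial.smult c g"
proof -
  define c where "c = some_gcd.listgcd (coeffs f)"
  have c_dvd: "c dvd Polynomial.coeff f k" for k
  proof (cases "Polynomial.coeff f k = 0")
    case False
    then show ?thesis
      unfolding c_def by (intro some_gcd.listgcd coeff_in_coeffs) (auto intro: le_degree)
  qed simp
  have "[:c:] dvd f"
    using c_dvd by (simp add: const_poly_dvd_iff)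
  then obtain g where f_eq: "f = Polynomial.smult c g"
    by (auto simp: dvd_def)
  have c0: "c \<noteq> 0"
    using assms f_eq by auto
  have "primitive g"
  proof (rule primitiveI)
    fix x assume x: "\<And>y. y \<in> set (coeffs g) \<Longrightarrow> x dvd y"
    have "c * x dvd c"
      unfolding c_def
    proof (rule some_gcd.listgcd_greatest)
      fix y assume "y \<in> set (coeffs f)"
      then obtain z where "z \<in> set (coeffs g)" "y = c * z"
        using c0 by (auto simp: f_eq coeffs_smult)
      then show "some_gcd.listgcd (coeffs f) * x dvd y"
        using x by (simp add: c_def[symmetric])
    qed
    then have "c * x dvd c * 1"
      by simp
    then show "x dvd 1"
      unfolding dvd_mult_cancel_left using c0 by blast
  qed
  with c0 f_eq show ?thesis by blast
qed

lemma primitive_dvd_cancel_prime: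
  fixes g f :: "'a::ufd poly"
  assumes g: "primitive g" and p: "prime_elem p" and dvd: "g dvd Polynomial.smult p f"
  shows "g dvd f"
proof -
  obtain h where h: "Polynomial.smult p f = g * h"
    using dvd by (auto simp: dvd_def)
  have p0: "p \<noteq> 0" and p_not_unit: "\<not> p dvd 1"
    using p by (auto simp: prime_elem_def)
  have "[:p:] dvd g * h"
    unfolding h[symmetric] by (auto simp: dvd_def)
  moreover have "\<not> [:p:] dvd g"
  proof
    assume "[:p:] dvd g"
    then have "p dvd y" if "y \<in> set (coeffs g)" for y
      using that by (auto simp: const_poly_dvd_iff coeffs_def split: if_splits)
    then show False
      using primitiveD[OF g] p_not_unit by blast
  qed
  ultimately have "[:p:] dvd h"
    using prime_elem_dvd_multD[OF lift_prime_elem_poly[OF p]] by blast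
  then obtain h' where "h = Polynomial.smult p h'"
    by (auto simp: dvd_def)
  then have "Polynomial.smult p f = Polynomial.smult p (g * h')"
    using h by simp
  then have "f = g * h'"
    using p0 by (metis smult_cancel)
  then show ?thesis by simp
qed

text \<open>
  This is the form in which Gauss's lemma enters: the prime factors of a constant stay prime as
  polynomials and do not divide a primitive one, so they can be cancelled one at a time.
\<close>

lemma primitive_dvd_cancel_const:
  fixes g f :: "'a::ufd poly"
  assumes g: "primitive g" and c: "c \<noteq> 0" and dvd: "g dvd Polynomial.smult c f"
  shows "g dvd f"
proof (cases "c dvd 1")
  case True
  then obtain d where d: "1 = c * d"
    by (auto simp: dvd_def)
  have "g dvd Polynomial.smult d (Polynomial.smult c f)"
    using dvd by (rule dvd_smult)
  then show ?thesis
    using d by (simp add: mult.commute)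
next
  case False
  then obtain F where F: "mset_factors F c"
    using mset_factors_exist[OF c] by blast
  have c_eq: "c = prod_mset F"
    using F by (auto simp: mset_factors_def)
  have "\<And>p. p \<in># F \<Longrightarrow> prime_elem p"
    using F by (auto simp: mset_factors_def)
  moreover have "g dvd Polynomial.smult (prod_mset F) f"
    using dvd c_eq by simp
  ultimately show ?thesis
  proof (induction F)
    case (add p F)
    have "g dvd Polynomial.smult p (Polynomial.smult (prod_mset F) f)"
      using add.prems(2) by simp
    then have "g dvd Polynomial.smult (prod_mset F) f"
      by (rule primitive_dvd_cancel_prime[OF g add.prems(1), rotated]) simp
    then show ?case
      by (rule add.IH[rotated]) (rule add.prems(1), simp)
  qed simp
qed

definition saturated_ideal :: "'a::comm_ring_1 poly set \<Rightarrow> bool" where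
  "saturated_ideal I \<longleftrightarrow>
     (\<forall>f\<in>I. \<forall>g\<in>I. f - g \<in> I) \<and> (\<forall>f\<in>I. \<forall>h. h * f \<in> I) \<and>
     (\<forall>c f. c \<noteq> 0 \<longrightarrow> Polynomial.smult c f \<in> I \<longrightarrow> f \<in> I)"

lemma saturated_ideal_Inter:
  assumes "\<And>x. x \<in> A \<Longrightarrow> saturated_ideal (I x)"
  shows "saturated_ideal (\<Inter>x\<in>A. I x)"
  unfolding saturated_ideal_def
proof (intro conjI ballI allI impI INT_I)
  show "f - g \<in> I x" if "f \<in> (\<Inter>x\<in>A. I x)" "g \<in> (\<Inter>x\<in>A. I x)" "x \<in> A" for f g x
    using assms[OF that(3)] that by (simp add: saturated_ideal_def)
  show "h * f \<in> I x" if "f \<in> (\<Inter>x\<in>A. I x)" "x \<in> A" for f h x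
    using assms[OF that(2)] that by (simp add: saturated_ideal_def)
  show "f \<in> I x" if "c \<noteq> 0" "Polynomial.smult c f \<in> (\<Inter>x\<in>A. I x)" "x \<in> A" for c f x
  proof -
    have "Polynomial.smult c f \<in> I x"
      using that by simp
    then show ?thesis
      using assms[OF that(3)] that(1) unfolding saturated_ideal_def by blast
  qed
qed

text \<open>
  Saturation allows the generator to be taken primitive, and pseudo-division by an element of
  least degree leaves remainder zero.
\<close>

lemma saturated_ideal_principal:
  fixes I :: "'a::ufd poly set"
  assumes I: "saturated_ideal I" and f0: "f0 \<in> I" "f0 \<noteq> 0"
  shows "\<exists>g. primitive g \<and> I = principal_ideal g"
proof -
  have diff: "f - g \<in> I" if "f \<in> I" "g \<in> I" for f g
    using I that by (auto simp: saturated_ideal_def)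
  have mult: "h * f \<in> I" if "f \<in> I" for f h
    using I that by (auto simp: saturated_ideal_def)
  have sat: "f \<in> I" if "c \<noteq> 0" "Polynomial.smult c f \<in> I" for c f
    using I that by (auto simp: saturated_ideal_def)
  obtain f where f: "f \<in> I" "f \<noteq> 0"
    and least: "\<And>h. h \<in> I \<Longrightarrow> h \<noteq> 0 \<Longrightarrow> degree f \<le> degree h"
    using ex_has_least_nat[of "\<lambda>h. h \<in> I \<and> h \<noteq> 0" f0 degree] f0 by blast
  obtain c g where c: "c \<noteq> 0" and g: "primitive g" and f_eq: "f = Polynomial.smult c g"
    using exists_primitive_part[OF f(2)] by blast
  have g_I: "g \<in> I" and g0: "g \<noteq> 0"
    using sat[OF c] f f_eq by auto
  have deg_g: "degree g = degree f"
    using c f_eq by simp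
  have "g dvd h" if h: "h \<in> I" for h
  proof -
    define r where "r = pseudo_mod h g"
    obtain a q where a: "a \<noteq> 0" and division: "Polynomial.smult a h = g * q + r"
      using pseudo_mod(1)[OF g0] unfolding r_def by blast
    have "r = [:a:] * h - q * g"
      using division by (simp add: algebra_simps)
    then have "r \<in> I"
      by (simp only:) (intro diff mult h g_I)
    then have "r = 0"
      using pseudo_mod(2)[OF g0, of h] least deg_g unfolding r_def by (metis not_le)
    then have "g dvd Polynomial.smult a h"
      using division by simp
    then show ?thesis
      using primitive_dvd_cancel_const[OF g a] by blast
  qed
  moreover have "h \<in> I" if "g dvd h" for h
    using that mult[OF g_I] by (auto simp: dvd_def mult.commute)
  ultimately have "I = principal_ideal g"
    by (auto simp: mem_principal_ideal_iff)
  with g show ?thesis by blast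
qed

lemma principal_ideal_some_lcm:
  assumes "\<And>h. h \<in> principal_ideal m \<longleftrightarrow> (\<forall>a\<in>A. a dvd h)"
  shows "principal_ideal (some_lcm A) = principal_ideal m"
proof -
  have "\<forall>a\<in>A. a dvd m"
    using assms[of m] by (simp add: mem_principal_ideal_iff)
  then have "is_lcm A m"
    using assms by (auto simp: is_lcm_def mem_principal_ideal_iff)
  then have lcm: "is_lcm A (some_lcm A)"
    unfolding some_lcm_def by (rule someI)
  have "some_lcm A dvd h \<longleftrightarrow> (\<forall>a\<in>A. a dvd h)" for h
    using lcm by (auto simp: is_lcm_def dest: dvd_trans)
  then show ?thesis
    using assms by (auto simp: mem_principal_ideal_iff)
qed

section \<open>Annihilators of one-dimensional sequences\<close>

lemma shift1_eq_sum:
  assumes "degree f \<le> N"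
  shows "shift1 f t b = (\<Sum>k\<le>N. Polynomial.coeff f k * t (b - int k))"
  unfolding shift1_def
  by (rule sum.mono_neutral_left) (use assms in \<open>auto simp: coeff_eq_0\<close>)

lemma shift1_diff: "shift1 (f - g) t b = shift1 f t b - shift1 g t b"
proof -
  define N where "N = max (degree f) (degree g)"
  have "degree (f - g) \<le> N"
    unfolding N_def by (rule degree_diff_le_max)
  then show ?thesis
    by (simp add: shift1_eq_sum[of _ N] N_def left_diff_distrib sum_subtractf)
qed

lemma shift1_add: "shift1 (f + g) t b = shift1 f t b + shift1 g t b"
proof -
  define N where "N = max (degree f) (degree g)"
  have "degree (f + g) \<le> N"
    unfolding N_def by (rule degree_add_le_max)
  then show ?thesis
    by (simp add: shift1_eq_sum[of _ N] N_def distrib_right sum.distrib)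
qed

lemma shift1_smult: "shift1 (Polynomial.smult c f) t b = c * shift1 f t b"
  by (subst shift1_eq_sum[OF degree_smult_le]) (simp add: shift1_def sum_distrib_left mult.assoc)

lemma shift1_pCons: "shift1 (pCons c f) t b = c * t b + shift1 f t (b - 1)"
proof -
  have "shift1 (pCons c f) t b
      = (\<Sum>k\<le>Suc (degree f). Polynomial.coeff (pCons c f) k * t (b - int k))"
    by (rule shift1_eq_sum[OF degree_pCons_le])
  also have "\<dots> = c * t b + shift1 f t (b - 1)"
    by (subst sum.atMost_Suc_shift) (simp add: shift1_def algebra_simps)
  finally show ?thesis .
qed

lemma shift1_mult: "shift1 (f * g) t b = shift1 f (shift1 g t) b"
proof (induction f arbitrary: b)
  case 0
  then show ?case by (simp add: shift1_def)
next
  case (pCons c f)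
  then show ?case
    by (simp add: shift1_add shift1_smult shift1_pCons)
qed

lemma saturated_ideal_Ann1:
  fixes t :: "int \<Rightarrow> 'a::idom"
  shows "saturated_ideal (Ann1 t)"
proof -
  have "h * f \<in> Ann1 t" if "f \<in> Ann1 t" for f h
    using that by (auto simp: Ann1_def shift1_mult shift1_def[of h])
  then show ?thesis
    by (auto simp: saturated_ideal_def Ann1_def shift1_diff shift1_smult)
qed

lemma Ann1_eq_principal_ideal_gamma:
  fixes t :: "int \<Rightarrow> 'a::ufd"
  assumes "f \<in> Ann1 t" "f \<noteq> 0"
  shows "Ann1 t = principal_ideal (gamma t)"
proof (cases "\<forall>a\<le>0. t a = 0")
  case True
  then have "Ann1 t = UNIV"
    by (auto simp: Ann1_def shift1_def)
  then show ?thesis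
    using True by (auto simp: gamma_def mem_principal_ideal_iff)
next
  case False
  then have gamma: "gamma t = (SOME g. primitive g \<and> Ann1 t = principal_ideal g)"
    unfolding gamma_def by (rule if_not_P)
  show ?thesis
    using someI_ex[OF saturated_ideal_principal[OF saturated_ideal_Ann1 assms]]
    unfolding gamma by blast
qed

section \<open>Shifts in a single direction\<close>

lemma shift_in_var:
  "shift (in_var i p) s b = (\<Sum>k\<le>degree p. Polynomial.coeff p k * s (b - axis i (int k)))"
proof -
  let ?e = "Poly_Mapping.single i :: nat \<Rightarrow> _"
  let ?g = "\<lambda>a. Poly_Mapping.lookup (in_var i p) a * s (b - (\<chi> j. int (Poly_Mapping.lookup a j)))"
  have lookup: "Poly_Mapping.lookup (in_var i p) (?e k) = Polynomial.coeff p k"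
    if "k \<le> degree p" for k
    using that by (simp add: in_var_def lookup_sum lookup_single when_def inj_eq[OF inj_single])
  have keys: "Poly_Mapping.keys (in_var i p) \<subseteq> ?e ` {..degree p}"
    unfolding in_var_def by (rule order_trans[OF keys_sum]) (auto split: if_splits)
  have axis: "(\<chi> j. int (Poly_Mapping.lookup (?e k) j)) = axis i (int k)" for k
    by (auto simp: vec_eq_iff axis_def lookup_single when_def)
  have "shift (in_var i p) s b = sum ?g (?e ` {..degree p})"
    unfolding shift_def
    by (rule sum.mono_neutral_left) (use keys in \<open>auto simp: in_keys_iff\<close>)
  also have "\<dots> = (\<Sum>k\<le>degree p. ?g (?e k))"
    by (subst sum.reindex) (auto intro: inj_on_subset[OF inj_single])
  also have "\<dots> = (\<Sum>k\<le>degree p. Polynomial.coeff p k * s (b - axis i (int k)))"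
    by (rule sum.cong) (simp_all add: lookup axis)
  finally show ?thesis .
qed

lemma shift1_seq_section:
  "shift1 p (seq_section s i a') a = shift (in_var i p) s (\<chi> j. if j = i then a else a' j)"
proof -
  have "(\<chi> j. if j = i then a - x else a' j) = (\<chi> j. if j = i then a else a' j) - axis i x" for x
    by (auto simp: vec_eq_iff axis_def)
  then show ?thesis
    by (simp add: shift1_def shift_in_var seq_section_def)
qed

lemma in_var_mem_Ann_imp_mem_Ann1:
  assumes "in_var i p \<in> Ann s" and "\<And>j. j \<noteq> i \<Longrightarrow> a' j \<le> 0"
  shows "p \<in> Ann1 (seq_section s i a')"
  unfolding Ann1_def shift1_seq_section
  using assms by (auto simp: Ann_def less_eq_vec_def)

lemma shift_in_var_commute:
  "shift (in_var i p) (shift (in_var j q) s) b = shift (in_var j q) (shift (in_var i p) s) b"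
  unfolding shift_in_var sum_distrib_left
  by (subst sum.swap) (simp add: algebra_simps)

lemma shift_eq_0_if_eq_0:
  assumes "\<And>b. b \<le> 0 \<Longrightarrow> s b = 0" and "b \<le> 0"
  shows "shift f s b = 0"
  unfolding shift_def
proof (intro sum.neutral ballI)
  fix a
  have "b - (\<chi> j. int (Poly_Mapping.lookup a j)) \<le> 0"
    using assms(2) by (force simp: less_eq_vec_def intro: order_trans)
  then show "Poly_Mapping.lookup f a * s (b - (\<chi> j. int (Poly_Mapping.lookup a j))) = 0"
    using assms(1) by simp
qed

section \<open>Vanishing on a box implies vanishing\<close>

text \<open>
  At an index \<open>b\<close> with \<open>b\<^sub>j \<le> -deg f\<^sub>j\<close>, the recurrence given by \<open>f\<^sub>j\<close> may be applied at
  \<open>b + deg f\<^sub>j e\<^sub>j\<close>. It relates \<open>u b\<close>, with the leading coefficient of \<open>f\<^sub>j\<close>, to values of \<open>u\<close> strictly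
  closer to the origin.
\<close>

lemma zero_on_box_imp_zero:
  fixes u :: "int ^ 'n::finite \<Rightarrow> 'a::idom"
  assumes nonzero: "\<And>j. j \<in> J \<Longrightarrow> f j \<noteq> 0"
    and recurrence: "\<And>j. j \<in> J \<Longrightarrow> in_var j (f j) \<in> Ann u"
    and box: "\<And>b. b \<le> 0 \<Longrightarrow> (\<And>j. j \<in> J \<Longrightarrow> - int (degree (f j)) < b $ j) \<Longrightarrow> u b = 0"
    and "b \<le> 0"
  shows "u b = 0"
  using \<open>b \<le> 0\<close>
proof (induction "\<Sum>j\<in>UNIV. nat (- (b $ j))" arbitrary: b rule: less_induct)
  case less
  show ?case
  proof (cases "\<forall>j\<in>J. - int (degree (f j)) < b $ j")
    case True
    then show ?thesis
      using box less.prems by blast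
  next
    case False
    then obtain j where j: "j \<in> J" and b_j: "b $ j \<le> - int (degree (f j))"
      by (auto simp: not_less)
    define d where "d = degree (f j)"
    define c where "c = b + axis j (int d)"
    have "c \<le> 0"
      using less.prems b_j by (auto simp: c_def d_def less_eq_vec_def axis_def)
    then have "0 = (\<Sum>k\<le>d. Polynomial.coeff (f j) k * u (c - axis j (int k)))"
      using recurrence[OF j] by (simp add: Ann_def shift_in_var d_def)
    also have "\<dots> = Polynomial.coeff (f j) d * u (c - axis j (int d))"
    proof -
      have "u (c - axis j (int k)) = 0" if k: "k < d" for k
      proof (rule less.hyps)
        have nth: "(c - axis j (int k)) $ l = (if l = j then b $ j + int d - int k else b $ l)" for l
          by (simp add: c_def axis_def)
        show "c - axis j (int k) \<le> 0"
          using less.prems b_j k by (auto simp: less_eq_vec_def nth d_def simp del: vector_minus_component)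
        show "(\<Sum>l\<in>UNIV. nat (- ((c - axis j (int k)) $ l))) < (\<Sum>l\<in>UNIV. nat (- (b $ l)))"
          using b_j k
          by (intro sum_strict_mono_ex1)
            (auto simp: nth d_def simp del: vector_minus_component intro!: exI[of _ j])
      qed
      then show ?thesis
        by (simp add: lessThan_Suc_atMost[symmetric])
    qed
    finally show ?thesis
      using nonzero[OF j] by (simp add: d_def c_def)
  qed
qed

lemma in_var_mem_Ann_if_mem_Ann1_on_box:
  fixes s :: "int ^ 'n::finite \<Rightarrow> 'a::idom"
  assumes f: "\<And>j. j \<noteq> i \<Longrightarrow> in_var j (f j) \<in> Ann s" "\<And>j. j \<noteq> i \<Longrightarrow> f j \<noteq> 0"
    and p: "\<And>a'. a' \<in> (\<Pi>\<^sub>E j\<in>UNIV - {i}. {- (int (degree (f j)) - 1)..0}) \<Longrightarrow>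
              p \<in> Ann1 (seq_section s i a')"
  shows "in_var i p \<in> Ann s"
proof -
  define u where "u = shift (in_var i p) s"
  have "u b = 0" if "b \<le> 0" for b
  proof (rule zero_on_box_imp_zero[where J = "UNIV - {i}" and f = f])
    fix j assume j: "j \<in> UNIV - {i}"
    show "f j \<noteq> 0"
      using f(2) j by simp
    have "shift (in_var j (f j)) u b = 0" if "b \<le> 0" for b
      unfolding u_def by (subst shift_in_var_commute, rule shift_eq_0_if_eq_0)
        (use f(1) j that in \<open>auto simp: Ann_def\<close>)
    then show "in_var j (f j) \<in> Ann u"
      by (simp add: Ann_def)
  next
    fix b :: "int ^ 'n"
    assume b: "b \<le> 0" and box: "\<And>j. j \<in> UNIV - {i} \<Longrightarrow> - int (degree (f j)) < b $ j"
    define a' where "a' = restrict (\<lambda>j. b $ j) (UNIV - {i})"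
    have "a' \<in> (\<Pi>\<^sub>E j\<in>UNIV - {i}. {- (int (degree (f j)) - 1)..0})"
      using b box by (force simp: a'_def less_eq_vec_def)
    then have "shift1 p (seq_section s i a') (b $ i) = 0"
      using p b by (auto simp: Ann1_def less_eq_vec_def)
    moreover have "(\<chi> j. if j = i then b $ i else a' j) = b"
      by (auto simp: vec_eq_iff a'_def)
    ultimately show "u b = 0"
      by (simp add: shift1_seq_section u_def)
  qed (fact that)
  then show ?thesis
    by (simp add: Ann_def u_def)
qed

section \<open>Univariate elements of the annihilator\<close>

theorem theorem4p16:
  fixes s :: "int ^ 'n \<Rightarrow> 'a::ufd"
    and f :: "'n::finite \<Rightarrow> 'a poly"
  assumes "CARD('n) \<ge> 2"
    and "potential TYPE('a)"
    and "\<exists>a\<le>0. s a \<noteq> 0"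
    and "\<forall>i. in_var i (f i) \<in> Ann s \<and> degree (f i) \<ge> 1"
  shows "\<forall>i. Ann s \<inter> range (in_var i) =
           in_var i ` principal_ideal (some_lcm
             {gamma (seq_section s i a') |a'.
                a' \<in> (\<Pi>\<^sub>E j\<in>UNIV - {i}. {- (int (degree (f j)) - 1)..0})})"
proof
  fix i
  define B where "B = (\<Pi>\<^sub>E j\<in>UNIV - {i}. {- (int (degree (f j)) - 1)..0})"
  define A where "A = {gamma (seq_section s i a') |a'. a' \<in> B}"
  define I where "I = (\<Inter>a'\<in>B. Ann1 (seq_section s i a'))"
  have f: "in_var j (f j) \<in> Ann s" "f j \<noteq> 0" for j
    using assms(4) by (auto dest: spec[of _ j])
  have mem_I: "p \<in> I" if "in_var i p \<in> Ann s" for p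
    using in_var_mem_Ann_imp_mem_Ann1[OF that] by (auto simp: I_def B_def PiE_iff)
  have Ann1_eq: "Ann1 (seq_section s i a') = principal_ideal (gamma (seq_section s i a'))"
    if "a' \<in> B" for a'
    using Ann1_eq_principal_ideal_gamma[of "f i"] mem_I f that by (auto simp: I_def)
  have I_iff: "p \<in> I \<longleftrightarrow> (\<forall>a\<in>A. a dvd p)" for p
    by (auto simp: I_def A_def Ann1_eq mem_principal_ideal_iff)
  have "saturated_ideal I"
    unfolding I_def by (intro saturated_ideal_Inter saturated_ideal_Ann1)
  then obtain m where m: "I = principal_ideal m"
    using saturated_ideal_principal[of I "f i"] mem_I f by blast
  then have I_eq: "principal_ideal (some_lcm A) = I"
    using principal_ideal_some_lcm[of m A] I_iff by simp
  have "in_var i p \<in> Ann s" if "p \<in> I" for p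
    using in_var_mem_Ann_if_mem_Ann1_on_box[of i f s p] f that by (auto simp: I_def B_def)
  then have "Ann s \<inter> range (in_var i) = in_var i ` I"
    using mem_I by blast
  then show "Ann s \<inter> range (in_var i) =
           in_var i ` principal_ideal (some_lcm
             {gamma (seq_section s i a') |a'.
                a' \<in> (\<Pi>\<^sub>E j\<in>UNIV - {i}. {- (int (degree (f j)) - 1)..0})})"
    using I_eq by (simp add: A_def B_def)
qed

end
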